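(* Let $G=(V,E)$ be a finite simple graph and let $\pi=v_1,\dots,v_n$ be an ordering of $V$. Suppose that \textsc{FirstFit}, run on the online graph $(G,\pi)$, uses exactly $x$ distinct colors, where $x\ge 2$. Then there exist a set $V'\subseteq V$ and an integer $q$ with $0\le q\le x-2$ such that $|V'|=x+q$ and $V'$ can be partitioned into $q+1$ subsets, each of which has at least two vertices and is a clique in $G$ (all its vertices are pairwise adjacent).
   Context: An online graph $(G,\pi)$ is a graph $G$ together with an ordering $\pi=v_1,\dots,v_n$ of its vertices, in which the vertices are revealed one at a time; when $v_i$ is revealed, its adjacencies to $v_1,\dots,v_{i-1}$ become known, and an online coloring algorithm must irrevocably assign $v_i$ a color so that the coloring stays proper (adjacent vertices get different colors). \textsc{FirstFit} uses a totally ordered set of colors $c_0<c_1<c_2<\cdots$ and assigns to each arriving vertex the smallest color not already assigned to one of its previously revealed neighbors. *)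

theory Defs
  imports Main "HOL-Library.Ramsey" "HOL-Library.Disjoint_Sets"
begin

definition finite_simple_graph :: "'a set \<Rightarrow> 'a set set \<Rightarrow> bool" where
  "finite_simple_graph V E \<longleftrightarrow> finite V \<and> E \<subseteq> nsets V 2"

definition vertex_ordering :: "'a list \<Rightarrow> 'a set \<Rightarrow> bool" where
  "vertex_ordering vs V \<longleftrightarrow> distinct vs \<and> set vs = V"

text \<open>The partial coloring \<open>c\<close> is defined exactly on the vertices revealed so far;
  the natural number \<open>k\<close> stands for the color $c_k$.\<close>

definition first_fit_step :: "'a set set \<Rightarrow> 'a \<Rightarrow> ('a \<rightharpoonup> nat) \<Rightarrow> ('a \<rightharpoonup> nat)" where
  "first_fit_step E v c = c(v \<mapsto> (LEAST k. \<forall>u \<in> dom c. {u, v} \<in> E \<longrightarrow> c u \<noteq> Some k))"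

definition first_fit :: "'a set set \<Rightarrow> 'a list \<Rightarrow> ('a \<rightharpoonup> nat)" where
  "first_fit E vs = fold (first_fit_step E) vs Map.empty"

end

theory Submission
  imports Defs
begin

text \<open>
  A \<^emph>\<open>Grundy\<close> labelling gives every vertex of label \<open>k\<close> a neighbor of each label below \<open>k\<close>;
  FirstFit produces one. If \<open>n\<close> vertices carry a Grundy labelling with maximal
  label \<open>m\<close>, they can be partitioned into at most \<open>n - m\<close> cliques: delete a vertex \<open>v\<close> of
  label \<open>m\<close> and partition the rest into \<open>k \<le> (n - 1) - (m - 1)\<close> cliques. Either \<open>v\<close> can be
  joined to one of them, or \<open>v\<close> has a non-neighbor in each of them; in the latter case the
  \<open>m\<close> neighbors of \<open>v\<close> and these \<open>k\<close> non-neighbors are distinct, so \<open>m + k \<le> n - 1\<close> and \<open>{v}\<close>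
  can be added as a further clique. Deleting vertices one at a time then removes the
  singleton cliques and makes the inequality an equality.
\<close>

section \<open>Clique partitions from Grundy labellings, and their trimming\<close>

definition grundy_on :: "'a set set \<Rightarrow> 'a set \<Rightarrow> ('a \<Rightarrow> nat) \<Rightarrow> bool" where
  "grundy_on E W c \<longleftrightarrow> (\<forall>v\<in>W. \<forall>i<c v. \<exists>u\<in>W. {u, v} \<in> E \<and> c u = i)"

definition clique_partition :: "'a set set \<Rightarrow> 'a set \<Rightarrow> 'a set set \<Rightarrow> bool" where
  "clique_partition E W P \<longleftrightarrow> partition_on W P \<and> (\<forall>C\<in>P. clique C E)"

lemma grundy_neighbors_card:
  assumes "grundy_on E W c" "finite W" "v \<in> W"
  shows "c v \<le> card {u \<in> W - {v}. {u, v} \<in> E}"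
proof -
  have "{..<c v} \<subseteq> c ` {u \<in> W - {v}. {u, v} \<in> E}"
    using assms(1,3) unfolding grundy_on_def by fastforce
  then have "card {..<c v} \<le> card {u \<in> W - {v}. {u, v} \<in> E}"
    using assms(2) by (intro surj_card_le) auto
  then show ?thesis
    by simp
qed

text \<open>Each class contributes an element outside \<open>N\<close>; these elements are distinct
  because the classes are disjoint.\<close>

lemma partition_on_card_le_transversal:
  assumes "partition_on W P" "finite W" "N \<subseteq> W" "\<And>C. C \<in> P \<Longrightarrow> \<not> C \<subseteq> N"
  shows "card P + card N \<le> card W"
proof -
  have "\<forall>C\<in>P. \<exists>u. u \<in> C \<and> u \<notin> N"
    using assms(4) by blast
  then obtain f where f: "\<And>C. C \<in> P \<Longrightarrow> f C \<in> C \<and> f C \<notin> N"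
    by metis
  have "inj_on f P"
    using f partition_onD2[OF assms(1)] by (intro inj_onI) (metis IntI disjointD empty_iff)
  moreover have "f ` P \<subseteq> W - N"
    using f partition_onD1[OF assms(1)] by blast
  ultimately have "card P \<le> card (W - N)"
    using assms(2) by (metis card_inj_on_le finite_Diff)
  then show ?thesis
    using assms(2,3) card_mono[OF assms(2,3)] by (simp add: card_Diff_subset finite_subset)
qed

lemma clique_partition_insert_extend:
  assumes "clique_partition E W P" "finite W" "v \<notin> W" "C \<in> P" "\<And>u. u \<in> C \<Longrightarrow> {u, v} \<in> E"
  obtains Q where "clique_partition E (insert v W) Q" "card Q = card P"
proof
  let ?Q = "insert (insert v C) (P - {C})"
  have part: "partition_on W P" and cl: "\<And>D. D \<in> P \<Longrightarrow> clique D E"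
    using assms(1) by (auto simp: clique_partition_def)
  have "clique (insert v C) E"
    using cl[OF assms(4)] assms(5) unfolding clique_def by (metis insert_commute insert_iff)
  moreover have "partition_on (insert v W) ?Q"
  proof -
    have "disjnt (insert v C) (\<Union>(P - {C}))"
      using part assms(3,4) by (auto simp: partition_on_def disjoint_def disjnt_iff)
    moreover have "partition_on (W - C) (P - {C})"
      using partition_on_insert[of C "P - {C}" W] part assms(4)
      by (auto simp: insert_absorb partition_on_def disjoint_def disjnt_iff)
    moreover have "insert v W - insert v C = W - C" "insert v C \<subseteq> insert v W"
      using assms(3,4) partition_onD1[OF part] by auto
    ultimately show ?thesis
      by (simp add: partition_on_insert)
  qed
  ultimately show "clique_partition E (insert v W) ?Q"
    using cl by (auto simp: clique_partition_def)
  \<comment> \<open>The enlarged class is new because \<open>v\<close> lies outside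
    \<open>W\<close>, so exchanging \<open>C\<close> for it preserves the number of classes.\<close>
  have "insert v C \<notin> P"
    using part assms(3) by (auto simp: partition_on_def)
  moreover have "finite P"
    using part assms(2) finite_elements by blast
  ultimately show "card ?Q = card P"
    using card.remove[of P C] assms(4) by simp
qed

lemma clique_partition_insert_singleton:
  assumes "clique_partition E W P" "finite W" "v \<notin> W"
  shows "clique_partition E (insert v W) (insert {v} P)" "card (insert {v} P) = Suc (card P)"
proof -
  have part: "partition_on W P" and cl: "\<forall>C\<in>P. clique C E"
    using assms(1) by (auto simp: clique_partition_def)
  show "clique_partition E (insert v W) (insert {v} P)"
    using cl partition_on_insert[of "{v}" P "insert v W"] part partition_onD1[OF part] assms(3)
    by (auto simp: clique_partition_def clique_def disjnt_def)
  have "{v} \<notin> P"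
    using part assms(3) by (auto simp: partition_on_def)
  then show "card (insert {v} P) = Suc (card P)"
    using finite_elements[OF assms(2) part] by simp
qed

text \<open>Vertices are inserted in nondecreasing order of label, so each new vertex has maximal
  label. Quantifying the bound over all \<open>w\<close> avoids a maximum over a possibly empty
  set.\<close>

lemma grundy_clique_partition:
  assumes "finite W" "grundy_on E W c"
  obtains P where "clique_partition E W P" "\<And>w. w \<in> W \<Longrightarrow> card P + c w \<le> card W"
proof -
  have "\<exists>P. clique_partition E W P \<and> (\<forall>w\<in>W. card P + c w \<le> card W)"
    using assms
  proof (induction W rule: finite_ranking_induct[where f = c])
    case empty
    then show ?case
      by (auto simp: clique_partition_def partition_on_def)
  next
    case (insert v W)
    have max: "\<And>w. w \<in> insert v W \<Longrightarrow> c w \<le> c v"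
      using insert.hyps(2) by auto
    show ?case
    \<comment> \<open>The ranking induction does not guarantee that the inserted vertex is
      new.\<close>
    proof (cases "v \<in> W")
      case True
      then show ?thesis
        using insert by (simp add: insert_absorb)
    next
      case v: False
      \<comment> \<open>A neighbor demanded by a vertex of \<open>W\<close> has a label strictly
        below \<open>c v\<close>, so it is never \<open>v\<close> itself.\<close>
      have "grundy_on E W c"
        using insert.prems max unfolding grundy_on_def by (metis insert_iff leD)
      then obtain P where P: "clique_partition E W P" "\<And>w. w \<in> W \<Longrightarrow> card P + c w \<le> card W"
        using insert.IH by blast
      have part: "partition_on W P"
        using P(1) by (simp add: clique_partition_def)
      define N where "N = {u \<in> W. {u, v} \<in> E}"
      have N: "c v \<le> card N"
        using grundy_neighbors_card[OF insert.prems, of v] insert.hyps(1) v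
        by (simp add: N_def)
      show ?thesis
      proof (cases "\<exists>C\<in>P. C \<subseteq> N")
        case True
        then obtain C where C: "C \<in> P" "C \<subseteq> N"
          by blast
        obtain Q where Q: "clique_partition E (insert v W) Q" "card Q = card P"
          using clique_partition_insert_extend[OF P(1) insert.hyps(1) v C(1)] C(2)
          by (auto simp: N_def)
        \<comment> \<open>The induction hypothesis bounds only labels inside \<open>W\<close>. A
          label of at least \<open>c v - 1\<close> occurs there, on any vertex of \<open>C\<close>
          if \<open>c v = 0\<close> and otherwise on a neighbor of \<open>v\<close>; the missing
          unit is made up by the growth of \<open>card W\<close>.\<close>
        obtain w where w: "w \<in> W" "c v \<le> Suc (c w)"
        proof (cases "c v")
          case 0
          have "C \<noteq> {}" "C \<subseteq> W"
            using part C(1) by (auto simp: partition_on_def)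
          then show ?thesis
            using that 0 by auto
        next
          case (Suc k)
          then obtain u where "u \<in> insert v W" "c u = k"
            using insert.prems unfolding grundy_on_def by (metis insertI1 lessI)
          then show ?thesis
            using that Suc by auto
        qed
        have "card Q + c v \<le> card (insert v W)"
          using P(2)[OF w(1)] w(2) Q(2) v insert.hyps(1) by simp
        then show ?thesis
          using Q(1) max by (meson add_left_mono order_trans)
      next
        case False
        then have "card P + card N \<le> card W"
          using part insert.hyps(1)
          by (intro partition_on_card_le_transversal) (auto simp: N_def)
        then have "card (insert {v} P) + c v \<le> card (insert v W)"
          using clique_partition_insert_singleton(2)[OF P(1) insert.hyps(1) v] N v insert.hyps(1)
          by simp
        then show ?thesis
          using clique_partition_insert_singleton(1)[OF P(1) insert.hyps(1) v] max
          by (meson add_left_mono order_trans)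
      qed
    qed
  qed
  then show thesis
    using that by blast
qed

text \<open>Restricting each class to \<open>W - {a}\<close> keeps it a clique. A class
  \<open>{a}\<close> becomes empty and is discarded, which makes the bound strict.\<close>

lemma clique_partition_remove:
  assumes "clique_partition E W P" "finite W"
  obtains Q where "clique_partition E (W - {a}) Q" "card Q \<le> card P"
    "{a} \<in> P \<Longrightarrow> card Q < card P"
proof
  let ?f = "(\<inter>) (W - {a})"
  let ?Q = "?f ` P - {{}}"
  have part: "partition_on W P" and fin: "finite P"
    using assms finite_elements by (auto simp: clique_partition_def)
  have "partition_on ((W - {a}) \<inter> W) ?Q"
    using partition_on_restrict[OF part] .
  then show "clique_partition E (W - {a}) ?Q"
    using assms(1) by (auto simp: clique_partition_def Int_absorb2 clique_def)
  have le: "card ?Q \<le> card (?f ` P)"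
    using fin by (intro card_mono) auto
  then show "card ?Q \<le> card P"
    using card_image_le[OF fin, of ?f] by linarith
  show "card ?Q < card P" if "{a} \<in> P"
  proof -
    have "?f {a} = {}"
      by blast
    then have "card ?Q < card (?f ` P)"
      using that fin by (intro psubset_card_mono) (auto simp: image_iff)
    then show ?thesis
      using card_image_le[OF fin, of ?f] by linarith
  qed
qed

text \<open>Deleting a vertex costs one on the right of the inequality. This is affordable if there
  is slack, or if the vertex forms a singleton class, which then disappears on the left. The process
  stops only when neither case applies.\<close>

lemma clique_partition_trim:
  assumes "finite W" "clique_partition E W P" "card P + m \<le> card W"
  obtains U Q where "U \<subseteq> W" "clique_partition E U Q" "\<And>C. C \<in> Q \<Longrightarrow> card C \<ge> 2"
    "card U = card Q + m"
proof -
  have "\<exists>U Q. U \<subseteq> W \<and> clique_partition E U Q \<and> (\<forall>C\<in>Q. card C \<ge> 2) \<and> card U = card Q + m"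
    using assms
  proof (induction W arbitrary: P rule: finite_psubset_induct)
    case (psubset W)
    have part: "partition_on W P"
      using psubset.prems(1) by (simp add: clique_partition_def)
    show ?case
    proof (cases "(\<forall>C\<in>P. card C \<ge> 2) \<and> card W = card P + m")
      case True
      then show ?thesis
        using psubset.prems by blast
    next
      case False
      have "\<exists>a\<in>W. {a} \<in> P \<or> card P + m < card W"
      proof (cases "\<forall>C\<in>P. card C \<ge> 2")
        case True
        then have "card P + m < card W"
          using False psubset.prems(2) by linarith
        \<comment> \<open>Any vertex will do here; one exists because \<open>card W\<close> is
          positive.\<close>
        then show ?thesis
          by (metis card.empty ex_in_conv not_less_zero)
      next
        case False
        then obtain C where C: "C \<in> P" "card C < 2"
          by (meson not_le)
        have "C \<noteq> {}" "C \<subseteq> W"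
          using part C(1) by (auto simp: partition_on_def)
        moreover from this have "card C \<noteq> 0"
          using psubset.hyps finite_subset card_0_eq by metis
        ultimately obtain a where "C = {a}"
          using C(2) by (metis One_nat_def card_1_singletonE less_2_cases)
        then show ?thesis
          using C(1) \<open>C \<subseteq> W\<close> by blast
      qed
      then obtain a where a: "a \<in> W" "{a} \<in> P \<or> card P + m < card W"
        by blast
      obtain Q where Q: "clique_partition E (W - {a}) Q" "card Q \<le> card P"
        "{a} \<in> P \<Longrightarrow> card Q < card P"
        using clique_partition_remove[OF psubset.prems(1) psubset.hyps] by blast
      have "card W = Suc (card (W - {a}))"
        using card_Suc_Diff1[OF psubset.hyps a(1)] by simp
      then have "card Q + m \<le> card (W - {a})"
        using a(2) Q(2,3) psubset.prems(2) by linarith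
      moreover have "W - {a} \<subset> W"
        using a(1) by blast
      ultimately show ?thesis
        using psubset.IH[OF _ Q(1)] by blast
    qed
  qed
  then show thesis
    using that by blast
qed

section \<open>FirstFit colorings as Grundy labellings\<close>

lemma first_fit_snoc: "first_fit E (vs @ [v]) = first_fit_step E v (first_fit E vs)"
  by (simp add: first_fit_def)

lemma dom_first_fit: "dom (first_fit E vs) = set vs"
proof (induction vs rule: rev_induct)
  case Nil
  show ?case
    by (simp add: first_fit_def)
next
  case (snoc v vs)
  then show ?case
    unfolding first_fit_snoc first_fit_step_def by (simp del: fun_upd_apply)
qed

text \<open>When \<open>v\<close> arrives, every color below the least admissible one is blocked by
  an earlier neighbor, and later steps do not recolor that neighbor.\<close>

lemma first_fit_smaller_color:
  assumes "distinct vs" "first_fit E vs v = Some k" "i < k"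
  shows "\<exists>u. {u, v} \<in> E \<and> first_fit E vs u = Some i"
  using assms
proof (induction vs arbitrary: v k i rule: rev_induct)
  case Nil
  then show ?case
    by (simp add: first_fit_def)
next
  case (snoc w vs)
  let ?c = "first_fit E vs"
  have w: "w \<notin> dom ?c"
    using snoc.prems(1) by (simp add: dom_first_fit)
  \<comment> \<open>As \<open>w\<close> is still uncolored, the update overwrites nothing.\<close>
  have keep: "first_fit E (vs @ [w]) u = Some j" if "?c u = Some j" for u j
    using that w by (auto simp: first_fit_snoc first_fit_step_def)
  have "\<exists>u. {u, v} \<in> E \<and> ?c u = Some i"
  proof (cases "v = w")
    case True
    then have "k = (LEAST k. \<forall>u\<in>dom ?c. {u, w} \<in> E \<longrightarrow> ?c u \<noteq> Some k)"
      using snoc.prems(2) by (simp add: first_fit_snoc first_fit_step_def)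
    then have "\<not> (\<forall>u\<in>dom ?c. {u, w} \<in> E \<longrightarrow> ?c u \<noteq> Some i)"
      using snoc.prems(3) not_less_Least by blast
    then show ?thesis
      using True by blast
  next
    case False
    then show ?thesis
      using snoc by (simp add: first_fit_snoc first_fit_step_def)
  qed
  then show ?case
    using keep by blast
qed

lemma grundy_on_first_fit:
  assumes "distinct vs"
  shows "grundy_on E (set vs) (\<lambda>v. the (first_fit E vs v))"
  unfolding grundy_on_def
proof (intro ballI allI impI)
  fix v i
  assume "v \<in> set vs" and i: "i < the (first_fit E vs v)"
  then have "first_fit E vs v = Some (the (first_fit E vs v))"
    using dom_first_fit[of E vs] by (metis domD option.sel)
  then obtain u where "{u, v} \<in> E" "first_fit E vs u = Some i"
    using first_fit_smaller_color[OF assms _ i] by blast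
  moreover from this have "u \<in> set vs"
    using dom_first_fit[of E vs] by blast
  ultimately show "\<exists>u\<in>set vs. {u, v} \<in> E \<and> the (first_fit E vs u) = i"
    by force
qed

theorem theorem1:
  fixes V :: "'a set" and E :: "'a set set" and vs :: "'a list" and x :: nat
  assumes "finite_simple_graph V E"
    and "vertex_ordering vs V"
    and "card (ran (first_fit E vs)) = x"
    and "x \<ge> 2"
  shows "\<exists>V' q. V' \<subseteq> V \<and> q \<le> x - 2 \<and> card V' = x + q \<and>
           (\<exists>P. partition_on V' P \<and> card P = q + 1 \<and>
                (\<forall>C \<in> P. card C \<ge> 2 \<and> clique C E))"
proof -
  let ?c = "first_fit E vs"
  have vs: "distinct vs" "set vs = V" and fin: "finite V"
    using assms(2) by (auto simp: vertex_ordering_def)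
  \<comment> \<open>There are only \<open>x - 1\<close> colors below \<open>x - 1\<close>, so
    \<open>x\<close> distinct colors include one that is at least \<open>x - 1\<close>.\<close>
  have "\<not> ran ?c \<subseteq> {..<x - 1}"
    using card_mono[of "{..<x - 1}" "ran ?c"] assms(3,4) by auto
  then obtain v k where "?c v = Some k" "x - 1 \<le> k"
    unfolding ran_def subset_iff lessThan_iff mem_Collect_eq by (meson not_less)
  then have v: "v \<in> V" "x - 1 \<le> the (?c v)"
    using dom_first_fit[of E vs] vs(2) by auto
  obtain P where P: "clique_partition E V P" "\<And>w. w \<in> V \<Longrightarrow> card P + the (?c w) \<le> card V"
    using grundy_clique_partition[OF fin] grundy_on_first_fit[OF vs(1)] vs(2) by metis
  have "card P + (x - 1) \<le> card V"
    using P(2)[OF v(1)] v(2) by linarith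
  then obtain U Q where U: "U \<subseteq> V" "clique_partition E U Q" "\<And>C. C \<in> Q \<Longrightarrow> card C \<ge> 2"
    "card U = card Q + (x - 1)"
    using clique_partition_trim[OF fin P(1)] by blast
  have part: "partition_on U Q"
    using U(2) by (simp add: clique_partition_def)
  have finU: "finite U"
    using U(1) fin finite_subset by blast
  \<comment> \<open>With \<open>q = card Q - 1\<close>, classes of size at least two give
    \<open>2 * card Q \<le> card Q + (x - 1)\<close>, hence \<open>q \<le> x - 2\<close>.\<close>
  have "card U = (\<Sum>C\<in>Q. card C)"
    using card_Union_disjoint[OF partition_onD2[OF part]] finU partition_onD1[OF part]
    by (metis Sup_upper finite_subset)
  moreover have "(\<Sum>C\<in>Q. 2) \<le> (\<Sum>C\<in>Q. card C)"
    using U(3) by (intro sum_mono)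
  ultimately have "2 * card Q \<le> card U"
    by simp
  \<comment> \<open>An empty \<open>Q\<close> would force \<open>U\<close> to be empty, against
    \<open>card U \<ge> x - 1 \<ge> 1\<close>. This makes the subtraction in
    \<open>card Q - 1\<close> exact.\<close>
  moreover have "card Q \<noteq> 0"
    using U(4) part finite_elements[OF finU part] assms(4) by (auto simp: partition_on_def)
  ultimately have "card Q - 1 \<le> x - 2" "card U = x + (card Q - 1)" "card Q = (card Q - 1) + 1"
    using U(4) assms(4) by linarith+
  then show ?thesis
    using U part by (metis clique_partition_def)
qed

end
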